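(* For every $\ell\in\mathbb{N}$ and for every finite coloring $\mathbb{N}=C_1\cup\ldots\cup C_r$ there exists a monochromatic $\ell$-term arithmetic progression, i.e. there exist $a,d\in\mathbb{N}$ and $i\in\{1,\ldots,r\}$ such that $a,\ a+d,\ \ldots,\ a+(\ell-1)d\in C_i$.
   Context: $\mathbb{N}=\{1,2,3,\ldots\}$ denotes the set of positive integers (so the common difference $d$ is nonzero). A finite coloring $\mathbb{N}=C_1\cup\ldots\cup C_r$ is a partition of $\mathbb{N}$ into finitely many pieces $C_1,\ldots,C_r$ (the colors). A subset of $\mathbb{N}$ is monochromatic for the coloring if it is contained in a single color $C_i$. *)

theory Defs
  imports Main "HOL-Library.Disjoint_Sets"
begin

text \<open>
  The positive integers are the set \<open>{1..}\<close> of naturals. The colors \<open>C 1, \<dots>, C r\<close> are pairwise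
  disjoint and cover it exactly; a color may be empty. Values of \<open>C\<close> outside \<open>{1..r}\<close> are
  irrelevant.
\<close>

definition finite_coloring :: "nat \<Rightarrow> (nat \<Rightarrow> nat set) \<Rightarrow> bool" where
  "finite_coloring r C \<longleftrightarrow> disjoint_family_on C {1..r} \<and> (\<Union>i\<in>{1..r}. C i) = {1..}"

end

theory Submission
  imports Defs "HOL-Library.Nat_Bijection"
begin

text \<open>
  This is van der Waerden's theorem, proved by colour focusing. By induction on the length \<open>l\<close>, a
  stronger finite form is shown: for a finite set of colours there is a bound \<open>N\<close>, the same for all
  colourings, such that a monochromatic progression of length \<open>l\<close> occurs below \<open>N\<close>.

  For the step from \<open>l\<close> to \<open>l + 1\<close>, consider monochromatic progressions \<open>p + d, \<dots>, p + l * d\<close>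
  (spokes) that all point at one focus \<open>p\<close> and have different colours. If \<open>p\<close> shares the colour of a
  spoke, then it extends that spoke to a progression of length \<open>l + 1\<close>. Otherwise one more spoke can
  be made (lemma \<open>focused_extend\<close>). Colour each window of \<open>M\<close> consecutive numbers by the word
  of colours seen in it; these words are again finitely many colours, so by the induction hypothesis
  for \<open>l\<close> there are \<open>l\<close> identically coloured windows in arithmetic progression. Walking from window
  to window while moving along a spoke inside the window gives a spoke of the old colour; standing
  still at the focus inside the window gives a spoke in the colour of the focus, which is new. All
  of these point at one place in the window that precedes the first. There cannot
  be more spokes than colours, so at some stage a progression of length \<open>l + 1\<close> must appear.
\<close>

section \<open>Monochromatic progressions and focused spokes\<close>

text \<open>
  The bound is on \<open>a + l * d\<close>, one step past the last term, so that it bounds \<open>d\<close> even for \<open>l = 1\<close>.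
\<close>

definition mono_AP_below :: "(nat \<Rightarrow> nat) \<Rightarrow> nat \<Rightarrow> nat \<Rightarrow> bool" where
  "mono_AP_below f l N \<longleftrightarrow> (\<exists>a d. 1 \<le> d \<and> a + l * d \<le> N \<and> (\<forall>k<l. f (a + k * d) = f a))"

text \<open>
  The colours form an arbitrary finite set of numbers and not an initial segment, so that words of
  colours, encoded as numbers, can serve as colours.
\<close>

definition van_der_Waerden_bound :: "nat set \<Rightarrow> nat \<Rightarrow> nat \<Rightarrow> bool" where
  "van_der_Waerden_bound A l N \<longleftrightarrow> (\<forall>f. range f \<subseteq> A \<longrightarrow> mono_AP_below f l N)"

text \<open>
  A spoke is given by its difference alone, so a family of \<open>s\<close> spokes is a set of
  \<open>s\<close> differences. Injectivity says that different spokes have different colours.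
\<close>

definition focused_below :: "(nat \<Rightarrow> nat) \<Rightarrow> nat \<Rightarrow> nat \<Rightarrow> nat \<Rightarrow> bool" where
  "focused_below f l s N \<longleftrightarrow> (\<exists>p D. finite D \<and> card D = s \<and> p < N \<and>
     (\<forall>d\<in>D. 1 \<le> d \<and> p + l * d < N \<and> (\<forall>k\<in>{1..l}. f (p + k * d) = f (p + d))) \<and>
     inj_on (\<lambda>d. f (p + d)) D)"

lemma mono_AP_below_shift:
  assumes "mono_AP_below (\<lambda>i. f (c + i)) l M" and "c + M \<le> N"
  shows "mono_AP_below f l N"
proof -
  obtain a d where "1 \<le> d" "a + l * d \<le> M" "\<forall>k<l. f (c + (a + k * d)) = f (c + a)"
    using assms(1) unfolding mono_AP_below_def by blast
  then have "1 \<le> d \<and> (c + a) + l * d \<le> N \<and> (\<forall>k<l. f ((c + a) + k * d) = f (c + a))"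
    using assms(2) by (simp add: add.assoc)
  then show ?thesis
    unfolding mono_AP_below_def by blast
qed

section \<open>One more spoke\<close>

text \<open>
  The windows of length \<open>M\<close> starting at \<open>N + b + k * d\<close> for \<open>k < l\<close> look alike. The shift by
  \<open>N\<close> leaves room for the window one step earlier, which contains the new focus.
\<close>

lemma equal_windows:
  assumes bound: "van_der_Waerden_bound (list_encode ` {xs. set xs \<subseteq> A \<and> length xs = M}) l N"
    and f: "range f \<subseteq> A"
  shows "\<exists>b d. 1 \<le> d \<and> b + l * d \<le> N \<and>
    (\<forall>k<l. \<forall>i<M. f (N + b + k * d + i) = f (N + b + i))"
proof -
  define w where "w x = map (\<lambda>i. f (N + x + i)) [0..<M]" for x
  have "range (list_encode \<circ> w) \<subseteq> list_encode ` {xs. set xs \<subseteq> A \<and> length xs = M}"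
    using range_subsetD[OF f] by (auto simp: w_def intro!: imageI)
  then have "mono_AP_below (list_encode \<circ> w) l N"
    using bound unfolding van_der_Waerden_bound_def by blast
  then obtain b d where bd: "1 \<le> d" "b + l * d \<le> N"
    and "\<forall>k<l. list_encode (w (b + k * d)) = list_encode (w b)"
    unfolding mono_AP_below_def by auto
  then have w_eq: "w (b + k * d) = w b" if "k < l" for k
    using that by (simp add: list_encode_eq)
  have "f (N + b + k * d + i) = f (N + b + i)" if "k < l" "i < M" for k i
    using arg_cong[OF w_eq[OF that(1)], of "\<lambda>xs. xs ! i"] that(2)
    by (simp add: w_def add.assoc)
  with bd show ?thesis by blast
qed

text \<open>
  The new differences are \<open>d\<close>, for the spoke that stands still at the old focus within its window,
  and \<open>d + e\<close> for every old difference \<open>e\<close>. The colour of the former is new: otherwise the old focus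
  would complete an old spoke to a progression of length \<open>l + 1\<close>. That progression \<open>p, \<dots>, p + l * e\<close>
  lies below \<open>M\<close>, but the point \<open>p + (l + 1) * e\<close> that \<open>mono_AP_below\<close> bounds is only known to be
  at most \<open>2 * M\<close>; this is the source of the term \<open>2 * M\<close>. The term \<open>2 * N\<close> bounds \<open>N + b\<close>.
\<close>

lemma focused_extend:
  assumes l: "1 \<le> l"
    and old: "\<And>f. range f \<subseteq> A \<Longrightarrow> \<not> mono_AP_below f (Suc l) M \<Longrightarrow> focused_below f l s M"
    and bound: "van_der_Waerden_bound (list_encode ` {xs. set xs \<subseteq> A \<and> length xs = M}) l N"
    and f: "range f \<subseteq> A"
    and no_AP: "\<not> mono_AP_below f (Suc l) (2 * N + 2 * M)"
  shows "focused_below f l (Suc s) (2 * N + 2 * M)"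
proof -
  obtain b d where d: "1 \<le> d" and bd: "b + l * d \<le> N"
    and window: "\<forall>k<l. \<forall>i<M. f (N + b + k * d + i) = f (N + b + i)"
    using equal_windows[OF bound f] by blast
  define h where "h i = f (N + b + i)" for i
  have no_AP_h: "\<not> mono_AP_below h (Suc l) (2 * M)"
    using no_AP bd mono_AP_below_shift[of f "N + b" "Suc l" "2 * M" "2 * N + 2 * M"]
    unfolding h_def by auto
  have "\<not> mono_AP_below h (Suc l) M"
    using no_AP_h mono_AP_below_shift[of h 0 "Suc l" M "2 * M"] by auto
  moreover have "range h \<subseteq> A"
    using f by (auto simp: h_def)
  ultimately have "focused_below h l s M"
    by (intro old)
  then obtain p D where D: "finite D" "card D = s" and p: "p < M"
    and spoke: "\<And>e. e \<in> D \<Longrightarrow> 1 \<le> e \<and> p + l * e < M \<and> (\<forall>k\<in>{1..l}. h (p + k * e) = h (p + e))"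
    and inj: "inj_on (\<lambda>e. h (p + e)) D"
    unfolding focused_below_def by blast
  have le_mult: "e \<le> l * e" for e
    using l by (cases l) auto
  have dN: "d \<le> N"
    using bd le_mult[of d] by linarith
  \<comment> \<open>The place of the old focus in the window that precedes the \<open>l\<close> equal ones.\<close>
  define q where "q = N + b - d + p"
  have walk: "f (q + k * (d + e)) = h (p + k * e)" if k: "k \<in> {1..l}" and e: "p + l * e < M" for k e
  proof -
    obtain k' where k': "k = Suc k'"
      using k by (cases k) auto
    have "k * e \<le> l * e"
      using k by simp
    then have i: "p + k * e < M"
      using e by linarith
    have "q + k * (d + e) = N + b + k' * d + (p + k * e)"
      using dN by (simp add: q_def k' algebra_simps)
    moreover have "k' < l"
      using k k' by simp
    ultimately show ?thesis
      using window i by (simp only: h_def)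
  qed
  have q_colour: "f (q + (d + e)) = h (p + e)" if "p + l * e < M" for e
    using walk[OF _ that, of 1] l by simp
  have new_colour: "h (p + e) \<noteq> h p" if e: "e \<in> D" for e
  proof
    assume eq: "h (p + e) = h p"
    have "h (p + k * e) = h p" if "k < Suc l" for k
    proof (cases "k = 0")
      case False
      then show ?thesis
        using spoke[OF e] eq that by (metis atLeastAtMost_iff less_Suc_eq_le less_one not_le)
    qed simp
    moreover have "p + Suc l * e \<le> 2 * M"
      using spoke[OF e] le_mult[of e] by (simp only: mult_Suc) linarith
    ultimately show False
      using no_AP_h spoke[OF e] unfolding mono_AP_below_def by blast
  qed
  \<comment> \<open>With the old focus as a degenerate spoke of difference 0, all new spokes are treated alike.\<close>
  define E where "E = insert 0 D"
  have E: "p + l * e < M" "\<forall>k\<in>{1..l}. h (p + k * e) = h (p + e)" if "e \<in> E" for e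
    using that spoke[of e] p by (auto simp: E_def)
  have "0 \<notin> D"
    using spoke by force
  then have card_E: "finite E" "card E = Suc s"
    using D by (auto simp: E_def)
  have "h p \<notin> (\<lambda>e. h (p + e)) ` D"
    using new_colour by force
  then have inj_E: "inj_on (\<lambda>e. h (p + e)) E"
    using inj by (auto simp: E_def)
  have "q < 2 * N + 2 * M"
    using bd p by (simp add: q_def)
  moreover have "finite ((+) d ` E)" "card ((+) d ` E) = Suc s"
    using card_E by (simp_all add: card_image)
  moreover have "1 \<le> d + e \<and> q + l * (d + e) < 2 * N + 2 * M \<and>
      (\<forall>k\<in>{1..l}. f (q + k * (d + e)) = f (q + (d + e)))" if "e \<in> E" for e
  proof -
    have "q + l * (d + e) \<le> N + (b + l * d) + (p + l * e)"
      by (simp add: q_def algebra_simps)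
    then have "q + l * (d + e) < 2 * N + 2 * M"
      using bd E(1)[OF \<open>e \<in> E\<close>] by linarith
    moreover have "f (q + k * (d + e)) = f (q + (d + e))" if "k \<in> {1..l}" for k
      using walk[OF that E(1)[OF \<open>e \<in> E\<close>]] q_colour[OF E(1)[OF \<open>e \<in> E\<close>]] E(2)[OF \<open>e \<in> E\<close>] that
      by metis
    ultimately show ?thesis
      using d by simp
  qed
  moreover have "inj_on (\<lambda>d'. f (q + d')) ((+) d ` E)"
  proof (rule inj_onI)
    fix x y
    assume "x \<in> (+) d ` E" "y \<in> (+) d ` E" and eq: "f (q + x) = f (q + y)"
    then obtain e e' where e: "e \<in> E" "x = d + e" and e': "e' \<in> E" "y = d + e'"
      by blast
    have "h (p + e) = h (p + e')"
      using eq q_colour[OF E(1)[OF e(1)]] q_colour[OF E(1)[OF e'(1)]] by (simp only: e e')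
    then show "x = y"
      using inj_onD[OF inj_E] e e' by blast
  qed
  ultimately show ?thesis
    unfolding focused_below_def by (intro exI[of _ q] exI[of _ "(+) d ` E"]) blast
qed

section \<open>The finite form and the theorem\<close>

lemma mono_AP_or_focused:
  assumes l: "1 \<le> l" and A: "finite A"
    and IH: "\<And>B. finite B \<Longrightarrow> \<exists>N. van_der_Waerden_bound B l N"
  shows "\<exists>N. \<forall>f. range f \<subseteq> A \<longrightarrow> \<not> mono_AP_below f (Suc l) N \<longrightarrow> focused_below f l s N"
proof (induction s)
  case 0
  have "focused_below f l 0 1" for f
    unfolding focused_below_def by (intro exI[of _ 0] exI[of _ "{}"]) simp
  then show ?case by blast
next
  case (Suc s)
  then obtain M where
    M: "\<And>f. range f \<subseteq> A \<Longrightarrow> \<not> mono_AP_below f (Suc l) M \<Longrightarrow> focused_below f l s M"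
    by blast
  have "finite (list_encode ` {xs. set xs \<subseteq> A \<and> length xs = M})"
    using A by (intro finite_imageI finite_lists_length_eq)
  then obtain N where "van_der_Waerden_bound (list_encode ` {xs. set xs \<subseteq> A \<and> length xs = M}) l N"
    using IH by blast
  then show ?case
    using focused_extend[OF l M] by blast
qed

lemma focused_below_le_card:
  assumes "focused_below f l s N" and "range f \<subseteq> A" and "finite A"
  shows "s \<le> card A"
proof -
  obtain p D where "card D = s" "inj_on (\<lambda>d. f (p + d)) D"
    using assms(1) unfolding focused_below_def by blast
  moreover have "(\<lambda>d. f (p + d)) ` D \<subseteq> A"
    using assms(2) by auto
  ultimately show ?thesis
    using card_inj_on_le assms(3) by blast
qed

text \<open>
  The set of colours is universally quantified inside the induction: the step for \<open>A\<close> uses the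
  hypothesis for the far larger set of colour words over \<open>A\<close>.
\<close>

lemma van_der_Waerden_bound_exists:
  assumes "1 \<le> l" and "finite A"
  shows "\<exists>N. van_der_Waerden_bound A l N"
  using assms
proof (induction l arbitrary: A rule: dec_induct)
  case base
  have "mono_AP_below f 1 1" for f
    unfolding mono_AP_below_def by (intro exI[of _ 0] exI[of _ 1]) simp
  then show ?case
    unfolding van_der_Waerden_bound_def by blast
next
  case (step l)
  obtain N where N: "\<And>f. range f \<subseteq> A \<Longrightarrow> \<not> mono_AP_below f (Suc l) N \<Longrightarrow>
      focused_below f l (Suc (card A)) N"
    using mono_AP_or_focused[OF step.hyps(1) step.prems step.IH] by blast
  have "mono_AP_below f (Suc l) N" if "range f \<subseteq> A" for f
    using focused_below_le_card[OF N that step.prems] that by fastforce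
  then show ?case
    unfolding van_der_Waerden_bound_def by blast
qed

theorem theorem2p1:
  fixes l r :: nat and C :: "nat \<Rightarrow> nat set"
  assumes "l \<ge> 1" and "finite_coloring r C"
  shows "\<exists>a d i. a \<ge> 1 \<and> d \<ge> 1 \<and> i \<in> {1..r} \<and> (\<forall>k<l. a + k * d \<in> C i)"
proof -
  have "\<exists>i\<in>{1..r}. Suc x \<in> C i" for x
    using assms(2) unfolding finite_coloring_def by (metis UN_iff atLeast_iff le_add1 plus_1_eq_Suc)
  then obtain f where f: "\<And>x. f x \<in> {1..r}" "\<And>x. Suc x \<in> C (f x)"
    by metis
  obtain N where "van_der_Waerden_bound {1..r} l N"
    using van_der_Waerden_bound_exists assms(1) by blast
  then have "mono_AP_below f l N"
    using f(1) unfolding van_der_Waerden_bound_def by blast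
  then obtain a d where "1 \<le> d" and AP: "\<forall>k<l. f (a + k * d) = f a"
    unfolding mono_AP_below_def by blast
  moreover have "Suc a + k * d \<in> C (f a)" if "k < l" for k
    using f(2)[of "a + k * d"] AP that by simp
  ultimately show ?thesis
    using f(1) by (intro exI[of _ "Suc a"] exI[of _ d] exI[of _ "f a"]) auto
qed

end
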